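(* Let $R$ be a Noetherian ring with a reduction relation $\Longrightarrow$ fulfilling (A1)–(A3), and let $k\ge 1$. If every ideal of $R$ has a finite Gröbner basis, then every submodule of $R^k$ has a finite Gröbner basis with respect to the reduction relation $\longrightarrow$ on $R^k$ induced by $\Longrightarrow$.
   Context: $R$ is an associative, not necessarily commutative ring with unit; "ideal" means two-sided ideal, $\mathrm{ideal}_R(B)$ is the ideal generated by $B$, and $R$ Noetherian means every ideal is finitely generated. A reduction relation on $R$ is a family of binary relations $\Longrightarrow_\beta$ on $R$, $\beta\in R$; for $B\subseteq R$ one has a relation $\Longrightarrow_B$, with reflexive symmetric transitive closure $\stackrel{*}{\Longleftrightarrow}_B$. Axioms: (A1) $\Longrightarrow_B=\bigcup_{\beta\in B}\Longrightarrow_\beta$, and $\Longrightarrow_B$ is terminating for every finite $B\subseteq R$. (A2) $\alpha\Longrightarrow_\beta\gamma$ implies $\alpha-\gamma\in\mathrm{ideal}_R(\{\beta\})$. (A3) $\alpha\Longrightarrow_\alpha 0$ for all $\alpha\in R\setminus\{0\}$. A subset $B\subseteq R$ is a Gröbner basis of $\mathfrak i=\mathrm{ideal}_R(B)$ if $\stackrel{*}{\Longleftrightarrow}_B$ equals the congruence $\equiv_{\mathfrak i}$ modulo $\mathfrak i$ and $\Longrightarrow_B$ is complete (terminating and confluent). Modules: $R^k$ is viewed with componentwise addition and with left and right multiplication by elements of $R$ (componentwise). A submodule is an additive subgroup closed under left and right multiplication by elements of $R$; $\langle S\rangle=\{\sum_i\sum_j\beta_{ij}\, a_i\,\beta_{ij}'\mid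 a_i\in S,\ \beta_{ij},\beta'_{ij}\in R\}$ (finite sums) is the submodule generated by $S$. For a submodule $\mathcal S$, $a\equiv_{\mathcal S}b$ iff $a-b\in\mathcal S$. Reduction on $R^k$: for $a=(\alpha_1,\dots,\alpha_k)$, $b=(\beta_1,\dots,\beta_k)$, $b$ reduces $a$ to $c$ (written $a\longrightarrow_b c$) at position $s$ if (a) $\beta_j=0$ for $1\le j<s$; (b) $\alpha_s\Longrightarrow_{\beta_s}\gamma_s$ with $\alpha_s=\gamma_s+\sum_{i=1}^n\delta_i\beta_s\delta_i'$ for some $\delta_i,\delta_i'\in R$; (c) $c=a-\sum_{i=1}^n\delta_i\, b\,\delta_i'=(\alpha_1,\dots,\alpha_{s-1},\gamma_s,\alpha_{s+1}-\sum_i\delta_i\beta_{s+1}\delta_i',\dots,\alpha_k-\sum_i\delta_i\beta_k\delta_i')$. $\longrightarrow_B=\bigcup_{b\in B}\longrightarrow_b$, with reflexive symmetric transitive closure $\stackrel{*}{\longleftrightarrow}_B$. A subset $B\subseteq R^k$ is a Gröbner basis of the submodule $\mathcal S=\langle B\rangle$ if $\stackrel{*}{\longleftrightarrow}_B$ equals $\equiv_{\mathcal S}$ and $\longrightarrow_B$ is complete. *)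

theory Defs
  imports
    "HOL-Algebra.Ring_Divisibility"
    "HOL-Algebra.Product_Groups"
    "HOL-Library.Confluence"
begin

text \<open>A family of binary relations is a curried predicate: \<open>red b a c\<close> means that
  \<open>b\<close> reduces \<open>a\<close> to \<open>c\<close>. The following serves both for the ring and for its powers.\<close>

definition red_by :: "('b \<Rightarrow> 'c \<Rightarrow> 'c \<Rightarrow> bool) \<Rightarrow> 'b set \<Rightarrow> 'c \<Rightarrow> 'c \<Rightarrow> bool" where
  "red_by red B a c \<longleftrightarrow> (\<exists>b\<in>B. red b a c)"

text \<open>The converse is needed because \<^const>\<open>wfp\<close> excludes infinite descending chains.\<close>

definition terminating :: "('a \<Rightarrow> 'a \<Rightarrow> bool) \<Rightarrow> bool" where
  "terminating r \<longleftrightarrow> wfp (r\<inverse>\<inverse>)"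

definition complete_red :: "('a \<Rightarrow> 'a \<Rightarrow> bool) \<Rightarrow> bool" where
  "complete_red r \<longleftrightarrow> terminating r \<and> confluentp r"

text \<open>Reduction by a set \<open>B\<close> is the union over \<open>B\<close> by definition of \<^const>\<open>red_by\<close>.
  \<^const>\<open>ring\<close> does not exclude the zero ring and does not require commutativity;
  ideals and \<open>Idl\<close> are two-sided.\<close>

locale reduction_relation = ring R for R (structure) +
  fixes red :: "'a \<Rightarrow> 'a \<Rightarrow> 'a \<Rightarrow> bool"
  assumes red_carrier:
      "red \<beta> \<alpha> \<gamma> \<Longrightarrow> \<beta> \<in> carrier R \<and> \<alpha> \<in> carrier R \<and> \<gamma> \<in> carrier R"
    and red_terminating: "\<lbrakk>finite B; B \<subseteq> carrier R\<rbrakk> \<Longrightarrow> terminating (red_by red B)"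
    and red_diff_in_Idl: "red \<beta> \<alpha> \<gamma> \<Longrightarrow> \<alpha> \<ominus> \<gamma> \<in> Idl {\<beta>}"
    and red_self: "\<alpha> \<in> carrier R - {\<zero>} \<Longrightarrow> red \<alpha> \<alpha> \<zero>"

text \<open>\<^const>\<open>equivclp\<close> is reflexive on the whole type, so the two equivalence relations are
  compared on the carrier. Outside of it the reduction relations are empty, whence
  completeness needs no such restriction. The same applies to powers of the ring below.\<close>

definition groebner_basis ::
    "('a, 'm) ring_scheme \<Rightarrow> ('a \<Rightarrow> 'a \<Rightarrow> 'a \<Rightarrow> bool) \<Rightarrow> 'a set \<Rightarrow> 'a set \<Rightarrow> bool" where
  "groebner_basis R red B I \<longleftrightarrow>
     B \<subseteq> carrier R \<and> I = Idl\<^bsub>R\<^esub> B \<and>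
     (\<forall>a\<in>carrier R. \<forall>b\<in>carrier R. equivclp (red_by red B) a b \<longleftrightarrow> a \<ominus>\<^bsub>R\<^esub> b \<in> I) \<and>
     complete_red (red_by red B)"

text \<open>An element of the power is a function on the positions \<open>{1..k}\<close>, equal to
  \<^const>\<open>undefined\<close> elsewhere.\<close>

definition power_group :: "('a, 'm) ring_scheme \<Rightarrow> nat \<Rightarrow> (nat \<Rightarrow> 'a) monoid" where
  "power_group R k = product_group {1..k} (\<lambda>_. add_monoid R)"

definition vec_left_mult ::
    "('a, 'm) ring_scheme \<Rightarrow> nat \<Rightarrow> 'a \<Rightarrow> (nat \<Rightarrow> 'a) \<Rightarrow> nat \<Rightarrow> 'a" where
  "vec_left_mult R k r a = (\<lambda>j\<in>{1..k}. r \<otimes>\<^bsub>R\<^esub> a j)"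

definition vec_right_mult ::
    "('a, 'm) ring_scheme \<Rightarrow> nat \<Rightarrow> (nat \<Rightarrow> 'a) \<Rightarrow> 'a \<Rightarrow> nat \<Rightarrow> 'a" where
  "vec_right_mult R k a r = (\<lambda>j\<in>{1..k}. a j \<otimes>\<^bsub>R\<^esub> r)"

definition vec_minus ::
    "('a, 'm) ring_scheme \<Rightarrow> nat \<Rightarrow> (nat \<Rightarrow> 'a) \<Rightarrow> (nat \<Rightarrow> 'a) \<Rightarrow> nat \<Rightarrow> 'a" where
  "vec_minus R k a b = (\<lambda>j\<in>{1..k}. a j \<ominus>\<^bsub>R\<^esub> b j)"

definition two_sided_submodule ::
    "('a, 'm) ring_scheme \<Rightarrow> nat \<Rightarrow> (nat \<Rightarrow> 'a) set \<Rightarrow> bool" where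
  "two_sided_submodule R k S \<longleftrightarrow>
     subgroup S (power_group R k) \<and>
     (\<forall>r\<in>carrier R. \<forall>a\<in>S. vec_left_mult R k r a \<in> S \<and> vec_right_mult R k a r \<in> S)"

text \<open>The sums are written componentwise; the empty sum yields the zero vector.\<close>

definition generated_submodule ::
    "('a, 'm) ring_scheme \<Rightarrow> nat \<Rightarrow> (nat \<Rightarrow> 'a) set \<Rightarrow> (nat \<Rightarrow> 'a) set" where
  "generated_submodule R k S =
     {(\<lambda>l\<in>{1..k}. \<Oplus>\<^bsub>R\<^esub>i\<in>{1..n}. \<Oplus>\<^bsub>R\<^esub>j\<in>{1..m i}. \<beta> i j \<otimes>\<^bsub>R\<^esub> a i l \<otimes>\<^bsub>R\<^esub> \<beta>' i j)
      | (n::nat) (m::nat \<Rightarrow> nat) a \<beta> \<beta>'.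
        \<forall>i\<in>{1..n}. a i \<in> S \<and> (\<forall>j\<in>{1..m i}. \<beta> i j \<in> carrier R \<and> \<beta>' i j \<in> carrier R)}"

definition vec_red_at ::
    "('a, 'm) ring_scheme \<Rightarrow> ('a \<Rightarrow> 'a \<Rightarrow> 'a \<Rightarrow> bool) \<Rightarrow> nat \<Rightarrow> nat \<Rightarrow>
     (nat \<Rightarrow> 'a) \<Rightarrow> (nat \<Rightarrow> 'a) \<Rightarrow> (nat \<Rightarrow> 'a) \<Rightarrow> bool" where
  "vec_red_at R red k s b a c \<longleftrightarrow>
     a \<in> carrier (power_group R k) \<and> b \<in> carrier (power_group R k) \<and> s \<in> {1..k} \<and>
     (\<forall>j\<in>{1..<s}. b j = \<zero>\<^bsub>R\<^esub>) \<and>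
     (\<exists>\<gamma> (n::nat) \<delta> \<delta>'.
        (\<forall>i\<in>{1..n}. \<delta> i \<in> carrier R \<and> \<delta>' i \<in> carrier R) \<and>
        red (b s) (a s) \<gamma> \<and>
        a s = \<gamma> \<oplus>\<^bsub>R\<^esub> (\<Oplus>\<^bsub>R\<^esub>i\<in>{1..n}. \<delta> i \<otimes>\<^bsub>R\<^esub> b s \<otimes>\<^bsub>R\<^esub> \<delta>' i) \<and>
        c = vec_minus R k a
              (\<lambda>j\<in>{1..k}. \<Oplus>\<^bsub>R\<^esub>i\<in>{1..n}. \<delta> i \<otimes>\<^bsub>R\<^esub> b j \<otimes>\<^bsub>R\<^esub> \<delta>' i))"

definition vec_red ::
    "('a, 'm) ring_scheme \<Rightarrow> ('a \<Rightarrow> 'a \<Rightarrow> 'a \<Rightarrow> bool) \<Rightarrow> nat \<Rightarrow>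
     (nat \<Rightarrow> 'a) \<Rightarrow> (nat \<Rightarrow> 'a) \<Rightarrow> (nat \<Rightarrow> 'a) \<Rightarrow> bool" where
  "vec_red R red k b a c \<longleftrightarrow> (\<exists>s. vec_red_at R red k s b a c)"

definition submodule_groebner_basis ::
    "('a, 'm) ring_scheme \<Rightarrow> ('a \<Rightarrow> 'a \<Rightarrow> 'a \<Rightarrow> bool) \<Rightarrow> nat \<Rightarrow>
     (nat \<Rightarrow> 'a) set \<Rightarrow> (nat \<Rightarrow> 'a) set \<Rightarrow> bool" where
  "submodule_groebner_basis R red k B S \<longleftrightarrow>
     B \<subseteq> carrier (power_group R k) \<and> S = generated_submodule R k B \<and>
     (\<forall>a\<in>carrier (power_group R k). \<forall>b\<in>carrier (power_group R k).
        equivclp (red_by (vec_red R red k) B) a b \<longleftrightarrow> vec_minus R k a b \<in> S) \<and>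
     complete_red (red_by (vec_red R red k) B)"

end

theory Submission
  imports Defs
begin

text \<open>For a submodule \<open>S\<close> and a position \<open>s\<close>, the \<open>s\<close>-th entries of those elements of \<open>S\<close> that
  vanish before \<open>s\<close> form an ideal \<open>I\<^sub>s\<close>. Lift the nonzero elements of a finite Groebner basis
  of each \<open>I\<^sub>s\<close> to vectors of \<open>S\<close> vanishing before \<open>s\<close>, and collect the lifts in \<open>B\<close>. Reduction by
  \<open>B\<close> decreases vectors lexicographically, hence terminates. If two normal forms congruent modulo
  \<open>S\<close> first differ at \<open>s\<close>, their \<open>s\<close>-th entries are congruent modulo \<open>I\<^sub>s\<close>, hence joinable, so one
  of them is reducible after all. Thus congruent vectors are joinable, which yields everything
  else; in particular elements of \<open>S\<close> reduce to zero, which is irreducible.\<close>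

section \<open>Terminating relations: normal forms and lexicographic descent\<close>

lemma terminating_normal_form:
  assumes "terminating r"
  obtains y where "r\<^sup>*\<^sup>* x y" "\<And>z. \<not> r y z"
proof -
  have "wfp (r\<inverse>\<inverse>)"
    using assms by (simp add: terminating_def)
  then have "\<exists>y. r\<^sup>*\<^sup>* x y \<and> (\<forall>z. \<not> r y z)"
  proof (induction x rule: wfp_induct_rule)
    case (less x)
    then show ?case
      by (metis conversep_iff converse_rtranclp_into_rtranclp rtranclp.rtrancl_refl)
  qed
  then show thesis
    using that by blast
qed

lemma terminating_irrefl: "terminating r \<Longrightarrow> \<not> r x x"
  unfolding terminating_def by (metis conversep_iff wfp_imp_irreflp irreflpD)

lemma terminating_asym: "terminating r \<Longrightarrow> r x y \<Longrightarrow> \<not> r y x"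
  unfolding terminating_def by (meson conversep_iff wfp_imp_asymp asympD)

text \<open>Read as lists of the fixed length \<open>k\<close>, the entries descend in the order
  \<open>lexn\<close>, whose well-foundedness depends on that fixed length. Nothing is asked of the
  entries after \<open>s\<close>, because a reduction at \<open>s\<close> may change them
  arbitrarily.\<close>

lemma terminating_lexicographic:
  fixes k :: nat
  assumes "terminating r"
    and step: "\<And>a c. q a c \<Longrightarrow> \<exists>s\<in>{1..k}. r (a s) (c s) \<and> (\<forall>j\<in>{1..<s}. c j = a j)"
  shows "terminating q"
proof -
  \<comment> \<open>The pairs are swapped so that the result of a step is the smaller
    element.\<close>
  let ?r = "{(y, x). r x y}"
  have "wf ?r"
    using assms(1) by (simp add: terminating_def wfp_def conversep_iff[abs_def])
  then have "wf (inv_image (lexn ?r k) (\<lambda>a. map a [1..<Suc k]))"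
    by (intro wf_inv_image wf_lexn)
  moreover have "{(c, a). q a c} \<subseteq> inv_image (lexn ?r k) (\<lambda>a. map a [1..<Suc k])"
  proof clarify
    fix c a assume "q a c"
    then obtain s where s: "s \<in> {1..k}" "r (a s) (c s)" "\<forall>j\<in>{1..<s}. c j = a j"
      using step by blast
    have split: "[1..<Suc k] = [1..<s] @ s # [Suc s..<Suc k]"
      using s(1) by (metis Suc_le_eq atLeastAtMost_iff le_SucI upt_add_eq_append upt_conv_Cons
          less_Suc_eq_le le_add_diff_inverse)
    have "map c [1..<s] = map a [1..<s]"
      using s(3) by simp
    then have "map c [1..<Suc k] = map a [1..<s] @ c s # map c [Suc s..<Suc k]"
      "map a [1..<Suc k] = map a [1..<s] @ a s # map a [Suc s..<Suc k]"
      unfolding split by simp_all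
    then have "\<exists>xys x y xs' ys'. map c [1..<Suc k] = xys @ x # xs'
        \<and> map a [1..<Suc k] = xys @ y # ys' \<and> (x, y) \<in> ?r"
      using s(2) by blast
    then show "(c, a) \<in> inv_image (lexn ?r k) (\<lambda>a. map a [1..<Suc k])"
      by (simp add: lexn_conv del: upt_Suc)
  qed
  ultimately have "wf {(c, a). q a c}"
    by (rule wf_subset)
  then show ?thesis
    by (simp add: terminating_def wfp_def conversep_iff[abs_def])
qed

context ring
begin

lemma carrier_power_group: "carrier (power_group R k) = {1..k} \<rightarrow>\<^sub>E carrier R"
  by (simp add: power_group_def)

section \<open>Elements of two-sided principal ideals as finite sums\<close>

lemma sandwich_sum_Suc:
  assumes "\<forall>i\<in>{1..Suc n}. \<delta> i \<in> carrier R \<and> \<delta>' i \<in> carrier R" "b \<in> carrier R"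
  shows "(\<Oplus>i\<in>{1..Suc n}. \<delta> i \<otimes> b \<otimes> \<delta>' i)
    = \<delta> (Suc n) \<otimes> b \<otimes> \<delta>' (Suc n) \<oplus> (\<Oplus>i\<in>{1..n}. \<delta> i \<otimes> b \<otimes> \<delta>' i)"
proof -
  have "{1..Suc n} = insert (Suc n) {1..n}"
    by auto
  then show ?thesis
    using assms by (auto intro!: finsum_insert)
qed

lemma sandwich_sum_closed:
  assumes "\<forall>i\<in>{1..n::nat}. \<delta> i \<in> carrier R \<and> \<delta>' i \<in> carrier R" "b \<in> carrier R"
  shows "(\<Oplus>i\<in>{1..n}. \<delta> i \<otimes> b \<otimes> \<delta>' i) \<in> carrier R"
  using assms by (intro finsum_closed) auto

text \<open>This is the two-sided ideal generated by \<open>b\<close>. Without commutativity, single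
  products on both sides of \<open>b\<close> need not be closed under addition. Building the sums
  one term at a time lets closure be proved by induction, without concatenating index
  ranges.\<close>

inductive_set sandwich_span for b where
  zero: "\<zero> \<in> sandwich_span b"
| step: "d \<in> carrier R \<Longrightarrow> d' \<in> carrier R \<Longrightarrow> x \<in> sandwich_span b
    \<Longrightarrow> d \<otimes> b \<otimes> d' \<oplus> x \<in> sandwich_span b"

lemma sandwich_span_closed: "x \<in> sandwich_span b \<Longrightarrow> b \<in> carrier R \<Longrightarrow> x \<in> carrier R"
  by (induction rule: sandwich_span.induct) auto

lemma ideal_sandwich_span:
  assumes b: "b \<in> carrier R"
  shows "ideal (sandwich_span b) R"
proof (rule idealI)
  note cl = sandwich_span_closed[OF _ b]
  show "ring R"
    by (rule ring_axioms)
  have add: "x \<oplus> y \<in> sandwich_span b" if "x \<in> sandwich_span b" "y \<in> sandwich_span b" for x y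
    using that
    by (induction rule: sandwich_span.induct)
      (auto simp: a_assoc b cl intro: sandwich_span.step)
  show left: "x \<otimes> a \<in> sandwich_span b" if "a \<in> sandwich_span b" "x \<in> carrier R" for a x
    using that
  proof (induction rule: sandwich_span.induct)
    case (step d d' y)
    then have "x \<otimes> (d \<otimes> b \<otimes> d' \<oplus> y) = (x \<otimes> d) \<otimes> b \<otimes> d' \<oplus> x \<otimes> y"
      by (simp add: r_distr m_assoc b cl)
    with step show ?case
      by (simp add: sandwich_span.step)
  qed (simp add: sandwich_span.zero)
  show "a \<otimes> x \<in> sandwich_span b" if "a \<in> sandwich_span b" "x \<in> carrier R" for a x
    using that
  proof (induction rule: sandwich_span.induct)
    case (step d d' y)
    then have "(d \<otimes> b \<otimes> d' \<oplus> y) \<otimes> x = d \<otimes> b \<otimes> (d' \<otimes> x) \<oplus> y \<otimes> x"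
      by (simp add: l_distr m_assoc b cl)
    with step show ?case
      by (simp add: sandwich_span.step)
  qed (simp add: sandwich_span.zero)
  show "subgroup (sandwich_span b) (add_monoid R)"
  proof (rule subgroup.intro)
    fix x assume x: "x \<in> sandwich_span b"
    \<comment> \<open>Negation is a left multiplication, under which closure is already
      known.\<close>
    have "\<ominus> x = (\<ominus> \<one>) \<otimes> x"
      using cl[OF x] by (simp add: l_minus)
    then show "inv\<^bsub>add_monoid R\<^esub> x \<in> sandwich_span b"
      using left[OF x, of "\<ominus> \<one>"] by (simp add: a_inv_def)
  qed (auto simp: add cl sandwich_span.zero)
qed

lemma sandwich_span_eq_sum:
  assumes "x \<in> sandwich_span b" "b \<in> carrier R"
  shows "\<exists>(n::nat) \<delta> \<delta>'. (\<forall>i\<in>{1..n}. \<delta> i \<in> carrier R \<and> \<delta>' i \<in> carrier R)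
    \<and> x = (\<Oplus>i\<in>{1..n}. \<delta> i \<otimes> b \<otimes> \<delta>' i)"
  using assms
proof (induction rule: sandwich_span.induct)
  case zero
  show ?case
    by (rule exI[of _ 0]) simp
next
  case (step d d' x)
  then obtain n :: nat and \<delta> \<delta>' where
    d: "\<forall>i\<in>{1..n}. \<delta> i \<in> carrier R \<and> \<delta>' i \<in> carrier R"
    and x: "x = (\<Oplus>i\<in>{1..n}. \<delta> i \<otimes> b \<otimes> \<delta>' i)"
    by auto
  \<comment> \<open>The new summand takes the fresh index \<open>Suc n\<close>, so the old
    coefficients stay in place.\<close>
  let ?\<delta> = "\<delta>(Suc n := d)" and ?\<delta>' = "\<delta>'(Suc n := d')"
  have d2: "\<forall>i\<in>{1..Suc n}. ?\<delta> i \<in> carrier R \<and> ?\<delta>' i \<in> carrier R"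
    using d step.hyps by (auto simp: le_Suc_eq)
  have "(\<Oplus>i\<in>{1..n}. ?\<delta> i \<otimes> b \<otimes> ?\<delta>' i) = x"
    unfolding x using d step.prems by (intro finsum_cong') auto
  then have "(\<Oplus>i\<in>{1..Suc n}. ?\<delta> i \<otimes> b \<otimes> ?\<delta>' i) = d \<otimes> b \<otimes> d' \<oplus> x"
    by (subst sandwich_sum_Suc[OF d2 step.prems]) simp
  with d2 show ?case
    by (intro exI[of _ "Suc n"] exI[of _ ?\<delta>] exI[of _ ?\<delta>']) auto
qed

text \<open>The span is an ideal containing \<open>b\<close>, so it contains the ideal generated by
  \<open>b\<close>. The sum supplies the coefficients that a reduction of vectors has to
  exhibit.\<close>

lemma Idl_singleton_eq_sum:
  assumes "x \<in> Idl {b}" "b \<in> carrier R"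
  shows "\<exists>(n::nat) \<delta> \<delta>'. (\<forall>i\<in>{1..n}. \<delta> i \<in> carrier R \<and> \<delta>' i \<in> carrier R)
    \<and> x = (\<Oplus>i\<in>{1..n}. \<delta> i \<otimes> b \<otimes> \<delta>' i)"
proof (rule sandwich_span_eq_sum)
  have "\<one> \<otimes> b \<otimes> \<one> \<oplus> \<zero> \<in> sandwich_span b"
    by (intro sandwich_span.intros one_closed)
  then have "Idl {b} \<subseteq> sandwich_span b"
    using assms(2) by (intro genideal_minimal ideal_sandwich_span) auto
  then show "x \<in> sandwich_span b"
    using assms(1) by blast
qed fact

section \<open>Closure properties of two-sided submodules\<close>

lemma two_sided_submodule_zero:
  "two_sided_submodule R k S \<Longrightarrow> (\<lambda>j\<in>{1..k}. \<zero>) \<in> S"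
  unfolding two_sided_submodule_def power_group_def
  by (auto dest: subgroup.one_closed)

lemma two_sided_submodule_add:
  "two_sided_submodule R k S \<Longrightarrow> a \<in> S \<Longrightarrow> b \<in> S \<Longrightarrow> (\<lambda>j\<in>{1..k}. a j \<oplus> b j) \<in> S"
  unfolding two_sided_submodule_def power_group_def
  by (auto dest: subgroup.m_closed)

lemma two_sided_submodule_subset:
  "two_sided_submodule R k S \<Longrightarrow> a \<in> S \<Longrightarrow> a \<in> {1..k} \<rightarrow>\<^sub>E carrier R"
  unfolding two_sided_submodule_def carrier_power_group[symmetric]
  by (auto dest: subgroup.mem_carrier)

lemma two_sided_submodule_smult:
  assumes "two_sided_submodule R k S" "a \<in> S" "r \<in> carrier R"
  shows "(\<lambda>j\<in>{1..k}. r \<otimes> a j) \<in> S" "(\<lambda>j\<in>{1..k}. a j \<otimes> r) \<in> S"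
  using assms unfolding two_sided_submodule_def vec_left_mult_def vec_right_mult_def by auto

lemma two_sided_submodule_minus:
  assumes "two_sided_submodule R k S" "a \<in> S" "b \<in> S"
  shows "vec_minus R k a b \<in> S"
proof -
  \<comment> \<open>Subtraction is the addition of a multiple by
    \<open>\<ominus> \<one>\<close>.\<close>
  have "(\<lambda>j\<in>{1..k}. a j \<oplus> (\<lambda>j\<in>{1..k}. \<ominus> \<one> \<otimes> b j) j) \<in> S"
    using assms by (intro two_sided_submodule_add two_sided_submodule_smult) auto
  also have "(\<lambda>j\<in>{1..k}. a j \<oplus> (\<lambda>j\<in>{1..k}. \<ominus> \<one> \<otimes> b j) j) = vec_minus R k a b"
    unfolding vec_minus_def using two_sided_submodule_subset[OF assms(1,3)]
    by (intro restrict_ext) (auto simp: PiE_iff l_minus minus_eq)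
  finally show ?thesis .
qed

lemma two_sided_submodule_sum:
  assumes S: "two_sided_submodule R k S"
    and f: "\<And>i. i \<in> {1..n::nat} \<Longrightarrow> (\<lambda>l\<in>{1..k}. f i l) \<in> S"
  shows "(\<lambda>l\<in>{1..k}. \<Oplus>i\<in>{1..n}. f i l) \<in> S"
  using f
proof (induction n)
  case 0
  then show ?case
    using two_sided_submodule_zero[OF S] by (simp add: restrict_def)
next
  case (Suc n)
  have cl: "f i l \<in> carrier R" if "i \<in> {1..Suc n}" "l \<in> {1..k}" for i l
    using two_sided_submodule_subset[OF S Suc.prems[OF that(1)]] that(2)
    by (auto simp: PiE_iff)
  have "(\<lambda>l\<in>{1..k}. (\<lambda>l\<in>{1..k}. f (Suc n) l) l \<oplus> (\<lambda>l\<in>{1..k}. \<Oplus>i\<in>{1..n}. f i l) l) \<in> S"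
    using Suc by (intro two_sided_submodule_add[OF S]) auto
  also have "(\<lambda>l\<in>{1..k}. (\<lambda>l\<in>{1..k}. f (Suc n) l) l \<oplus> (\<lambda>l\<in>{1..k}. \<Oplus>i\<in>{1..n}. f i l) l)
      = (\<lambda>l\<in>{1..k}. \<Oplus>i\<in>{1..Suc n}. f i l)"
  proof (rule restrict_ext)
    fix l assume l: "l \<in> {1..k}"
    have "{1..Suc n} = insert (Suc n) {1..n}"
      by auto
    then show "(\<lambda>l\<in>{1..k}. f (Suc n) l) l \<oplus> (\<lambda>l\<in>{1..k}. \<Oplus>i\<in>{1..n}. f i l) l
        = (\<Oplus>i\<in>{1..Suc n}. f i l)"
      using l cl by (simp add: Pi_iff)
  qed
  finally show ?case .
qed

lemma two_sided_submodule_sandwich_sum: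
  assumes S: "two_sided_submodule R k S" and a: "a \<in> S"
    and d: "\<forall>i\<in>{1..n::nat}. \<delta> i \<in> carrier R \<and> \<delta>' i \<in> carrier R"
  shows "(\<lambda>l\<in>{1..k}. \<Oplus>i\<in>{1..n}. \<delta> i \<otimes> a l \<otimes> \<delta>' i) \<in> S"
proof (rule two_sided_submodule_sum[OF S])
  fix i assume "i \<in> {1..n}"
  then have "(\<lambda>l\<in>{1..k}. (\<lambda>l\<in>{1..k}. \<delta> i \<otimes> a l) l \<otimes> \<delta>' i) \<in> S"
    using d by (intro two_sided_submodule_smult[OF S] a) auto
  then show "(\<lambda>l\<in>{1..k}. \<delta> i \<otimes> a l \<otimes> \<delta>' i) \<in> S"
    by (simp cong: restrict_cong)
qed

section \<open>Membership in generated submodules\<close>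

lemma generated_submodule_subset:
  assumes S: "two_sided_submodule R k S" and "B \<subseteq> S"
  shows "generated_submodule R k B \<subseteq> S"
proof
  fix x assume "x \<in> generated_submodule R k B"
  then obtain n m a \<beta> \<beta>' where
    x: "x = (\<lambda>l\<in>{1..k}. \<Oplus>i\<in>{1..n::nat}. \<Oplus>j\<in>{1..m i::nat}. \<beta> i j \<otimes> a i l \<otimes> \<beta>' i j)"
    and d: "\<forall>i\<in>{1..n}. a i \<in> B \<and> (\<forall>j\<in>{1..m i}. \<beta> i j \<in> carrier R \<and> \<beta>' i j \<in> carrier R)"
    unfolding generated_submodule_def by blast
  show "x \<in> S"
    unfolding x
  proof (rule two_sided_submodule_sum[OF S])
    fix i assume "i \<in> {1..n}"
    then show "(\<lambda>l\<in>{1..k}. \<Oplus>j\<in>{1..m i}. \<beta> i j \<otimes> a i l \<otimes> \<beta>' i j) \<in> S"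
      using d assms(2) by (intro two_sided_submodule_sandwich_sum[OF S]) blast+
  qed
qed

lemma zero_in_generated_submodule: "(\<lambda>l\<in>{1..k}. \<zero>) \<in> generated_submodule R k B"
  unfolding generated_submodule_def mem_Collect_eq by (rule exI[of _ 0]) auto

text \<open>The added sum becomes the outer summand with index \<open>Suc n\<close>, which has
  \<open>p\<close> inner terms. Since undoing one reduction step adds such a sum, membership passes
  from the result of a step back to its source.\<close>

lemma generated_submodule_add_sandwich_sum:
  assumes c: "c \<in> generated_submodule R k B"
    and B: "B \<subseteq> carrier (power_group R k)" and b: "b \<in> B"
    and d: "\<forall>i\<in>{1..p::nat}. \<delta> i \<in> carrier R \<and> \<delta>' i \<in> carrier R"
  shows "(\<lambda>l\<in>{1..k}. c l \<oplus> (\<Oplus>i\<in>{1..p}. \<delta> i \<otimes> b l \<otimes> \<delta>' i)) \<in> generated_submodule R k B"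
proof -
  obtain n m a \<beta> \<beta>' where
    c_eq: "c = (\<lambda>l\<in>{1..k}. \<Oplus>i\<in>{1..n::nat}. \<Oplus>j\<in>{1..m i::nat}. \<beta> i j \<otimes> a i l \<otimes> \<beta>' i j)"
    and 0: "\<forall>i\<in>{1..n}. a i \<in> B \<and> (\<forall>j\<in>{1..m i}. \<beta> i j \<in> carrier R \<and> \<beta>' i j \<in> carrier R)"
    using c unfolding generated_submodule_def by blast
  have Bcl: "x l \<in> carrier R" if "x \<in> B" "l \<in> {1..k}" for x l
    using B that by (auto simp: carrier_power_group PiE_iff)
  let ?m = "m(Suc n := p)" and ?a = "a(Suc n := b)" and ?\<beta> = "\<beta>(Suc n := \<delta>)"
    and ?\<beta>' = "\<beta>'(Suc n := \<delta>')"
  have 1: "\<forall>i\<in>{1..Suc n}. ?a i \<in> B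
      \<and> (\<forall>j\<in>{1..?m i}. ?\<beta> i j \<in> carrier R \<and> ?\<beta>' i j \<in> carrier R)"
    using 0 b d by (auto simp: le_Suc_eq)
  have "(\<lambda>l\<in>{1..k}. c l \<oplus> (\<Oplus>i\<in>{1..p}. \<delta> i \<otimes> b l \<otimes> \<delta>' i))
      = (\<lambda>l\<in>{1..k}. \<Oplus>i\<in>{1..Suc n}. \<Oplus>j\<in>{1..?m i}. ?\<beta> i j \<otimes> ?a i l \<otimes> ?\<beta>' i j)"
  proof (rule restrict_ext)
    fix l assume l: "l \<in> {1..k}"
    have eq: "{1..Suc n} = insert (Suc n) {1..n}"
      by auto
    have cl: "(\<Oplus>j\<in>{1..?m i}. ?\<beta> i j \<otimes> ?a i l \<otimes> ?\<beta>' i j) \<in> carrier R" if "i \<in> {1..Suc n}" for i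
      using 1 that Bcl[OF _ l] by (intro sandwich_sum_closed) blast+
    have cl': "(\<Oplus>j\<in>{1..m i}. \<beta> i j \<otimes> a i l \<otimes> \<beta>' i j) \<in> carrier R" if "i \<in> {1..n}" for i
      using 0 that Bcl[OF _ l] by (intro sandwich_sum_closed) auto
    have c_closed: "c l \<in> carrier R"
      unfolding c_eq restrict_apply'[OF l] using cl' by (intro finsum_closed) blast
    have "(\<Oplus>i\<in>{1..Suc n}. \<Oplus>j\<in>{1..?m i}. ?\<beta> i j \<otimes> ?a i l \<otimes> ?\<beta>' i j)
      = (\<Oplus>j\<in>{1..?m (Suc n)}. ?\<beta> (Suc n) j \<otimes> ?a (Suc n) l \<otimes> ?\<beta>' (Suc n) j)
        \<oplus> (\<Oplus>i\<in>{1..n}. \<Oplus>j\<in>{1..?m i}. ?\<beta> i j \<otimes> ?a i l \<otimes> ?\<beta>' i j)"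
      unfolding eq by (intro finsum_insert) (use cl in \<open>simp_all add: Pi_iff del: fun_upd_apply\<close>)
    also have "(\<Oplus>i\<in>{1..n}. \<Oplus>j\<in>{1..?m i}. ?\<beta> i j \<otimes> ?a i l \<otimes> ?\<beta>' i j) = c l"
      unfolding c_eq restrict_apply'[OF l]
    proof (rule finsum_cong'[OF refl])
      show "(\<lambda>i. \<Oplus>j\<in>{1..m i}. \<beta> i j \<otimes> a i l \<otimes> \<beta>' i j) \<in> {1..n} \<rightarrow> carrier R"
        using cl' by blast
    qed simp
    finally show "c l \<oplus> (\<Oplus>i\<in>{1..p}. \<delta> i \<otimes> b l \<otimes> \<delta>' i)
        = (\<Oplus>i\<in>{1..Suc n}. \<Oplus>j\<in>{1..?m i}. ?\<beta> i j \<otimes> ?a i l \<otimes> ?\<beta>' i j)"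
      using sandwich_sum_closed[OF d Bcl[OF b l]] c_closed by (simp add: a_comm)
  qed
  with 1 show ?thesis
    unfolding generated_submodule_def by blast
qed

section \<open>Ideals of leading entries\<close>

text \<open>Addition and multiplication from either side act entrywise and preserve vanishing before
  \<open>s\<close>, so the ideal laws are inherited from \<open>S\<close>. The existence of Groebner
  bases in the ring is applied to these ideals.\<close>

lemma ideal_leading_entries:
  assumes S: "two_sided_submodule R k S" and s: "s \<in> {1..k}"
  shows "ideal {a s | a. a \<in> S \<and> (\<forall>j\<in>{1..<s}. a j = \<zero>)} R"
proof (rule idealI)
  let ?I = "{a s | a. a \<in> S \<and> (\<forall>j\<in>{1..<s}. a j = \<zero>)}"
  have I: "?I \<subseteq> carrier R"
    using s by (auto dest!: two_sided_submodule_subset[OF S])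
  \<comment> \<open>Witnesses are taken as restricted functions, the form in which the closure
    lemmas for \<open>S\<close> provide them.\<close>
  have memI: "x \<in> ?I" if "(\<lambda>j\<in>{1..k}. f j) \<in> S" "f s = x" "\<And>j. j \<in> {1..<s} \<Longrightarrow> f j = \<zero>" for f x
    using that s by (auto intro!: exI[of _ "\<lambda>j\<in>{1..k}. f j"])
  show "ring R"
    by (rule ring_axioms)
  show left: "x \<otimes> y \<in> ?I" if y: "y \<in> ?I" and x: "x \<in> carrier R" for x y
  proof -
    obtain a where a: "a \<in> S" "a s = y" "\<forall>j\<in>{1..<s}. a j = \<zero>"
      using y by blast
    then show ?thesis
      using x by (intro memI[OF two_sided_submodule_smult(1)[OF S a(1) x]]) auto
  qed
  show "y \<otimes> x \<in> ?I" if y: "y \<in> ?I" and x: "x \<in> carrier R" for x y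
  proof -
    obtain a where a: "a \<in> S" "a s = y" "\<forall>j\<in>{1..<s}. a j = \<zero>"
      using y by blast
    then show ?thesis
      using x by (intro memI[OF two_sided_submodule_smult(2)[OF S a(1) x]]) auto
  qed
  show "subgroup ?I (add_monoid R)"
  proof (rule subgroup.intro)
    show "?I \<subseteq> carrier (add_monoid R)"
      using I by simp
    show "\<one>\<^bsub>add_monoid R\<^esub> \<in> ?I"
      by (rule memI[OF two_sided_submodule_zero[OF S]]) auto
    show "x \<otimes>\<^bsub>add_monoid R\<^esub> y \<in> ?I" if xy: "x \<in> ?I" "y \<in> ?I" for x y
    proof -
      obtain a b where a: "a \<in> S" "a s = x" "\<forall>j\<in>{1..<s}. a j = \<zero>"
        and b: "b \<in> S" "b s = y" "\<forall>j\<in>{1..<s}. b j = \<zero>"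
        using xy by blast
      then show ?thesis
        by (intro memI[OF two_sided_submodule_add[OF S a(1) b(1)]]) auto
    qed
    fix x assume x: "x \<in> ?I"
    then have "\<ominus> x = (\<ominus> \<one>) \<otimes> x"
      using I by (auto simp: l_minus)
    then show "inv\<^bsub>add_monoid R\<^esub> x \<in> ?I"
      using left[OF x, of "\<ominus> \<one>"] by (simp add: a_inv_def)
  qed
qed

end

context reduction_relation
begin

section \<open>Zero in the reduction relation of the ring\<close>

lemma not_red_by_zero: "\<not> red \<zero> \<alpha> \<gamma>"
proof
  assume r: "red \<zero> \<alpha> \<gamma>"
  then have "\<alpha> \<ominus> \<gamma> = \<zero>"
    using red_diff_in_Idl[OF r] genideal_zero by auto
  then have "\<alpha> = \<gamma>"
    using red_carrier[OF r] by (simp add: r_right_minus_eq)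
  then show False
    using r terminating_irrefl[OF red_terminating[of "{\<zero>}"]] by (auto simp: red_by_def)
qed

text \<open>Otherwise axiom (A3) would lead back from \<open>\<gamma>\<close> to zero.\<close>

lemma zero_irreducible: "\<not> red \<beta> \<zero> \<gamma>"
proof
  assume r: "red \<beta> \<zero> \<gamma>"
  have t: "terminating (red_by red {\<beta>, \<gamma>})"
    using red_carrier[OF r] by (intro red_terminating) auto
  have "red_by red {\<beta>, \<gamma>} \<zero> \<gamma>"
    using r by (auto simp: red_by_def)
  moreover have "\<gamma> = \<zero> \<or> red_by red {\<beta>, \<gamma>} \<gamma> \<zero>"
    using red_self[of \<gamma>] red_carrier[OF r] by (auto simp: red_by_def)
  ultimately show False
    using terminating_irrefl[OF t] terminating_asym[OF t] by metis
qed

section \<open>Single reduction steps between vectors\<close>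

text \<open>At \<open>s\<close> the subtracted sum turns \<open>a s\<close> into the reduct
  prescribed in the ring, and before \<open>s\<close> it is zero because \<open>b\<close> vanishes
  there. The last fact reads the step backwards; it serves both for congruence modulo the submodule
  and for membership in the generated submodule.\<close>

lemma vec_red_atD:
  assumes "vec_red_at R red k s b a c"
  shows "red (b s) (a s) (c s)"
    and "\<forall>j\<in>{1..<s}. c j = a j"
    and "a \<in> carrier (power_group R k)" "c \<in> carrier (power_group R k)"
    and "\<exists>(n::nat) \<delta> \<delta>'. (\<forall>i\<in>{1..n}. \<delta> i \<in> carrier R \<and> \<delta>' i \<in> carrier R)
      \<and> a = (\<lambda>j\<in>{1..k}. c j \<oplus> (\<Oplus>i\<in>{1..n}. \<delta> i \<otimes> b j \<otimes> \<delta>' i))"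
proof -
  obtain \<gamma> and n :: nat and \<delta> \<delta>' where
    ab: "a \<in> carrier (power_group R k)" "b \<in> carrier (power_group R k)"
    and s: "s \<in> {1..k}" and b0: "\<forall>j\<in>{1..<s}. b j = \<zero>"
    and d: "\<forall>i\<in>{1..n}. \<delta> i \<in> carrier R \<and> \<delta>' i \<in> carrier R"
    and r: "red (b s) (a s) \<gamma>"
    and as: "a s = \<gamma> \<oplus> (\<Oplus>i\<in>{1..n}. \<delta> i \<otimes> b s \<otimes> \<delta>' i)"
    and c: "c = vec_minus R k a (\<lambda>j\<in>{1..k}. \<Oplus>i\<in>{1..n}. \<delta> i \<otimes> b j \<otimes> \<delta>' i)"
    using assms unfolding vec_red_at_def by auto
  have cl: "a j \<in> carrier R" "(\<Oplus>i\<in>{1..n}. \<delta> i \<otimes> b j \<otimes> \<delta>' i) \<in> carrier R" if "j \<in> {1..k}" for j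
    using ab that sandwich_sum_closed[OF d] by (auto simp: carrier_power_group PiE_iff)
  have cj: "c j = a j \<ominus> (\<Oplus>i\<in>{1..n}. \<delta> i \<otimes> b j \<otimes> \<delta>' i)" if "j \<in> {1..k}" for j
    using that by (simp add: c vec_minus_def)
  show "a \<in> carrier (power_group R k)" by fact
  show "c \<in> carrier (power_group R k)"
    using cl by (simp add: carrier_power_group c vec_minus_def)
  have "c s = \<gamma>"
    using red_carrier[OF r] cl(2)[OF s] as by (simp add: cj[OF s] minus_eq a_assoc r_neg)
  with r show "red (b s) (a s) (c s)"
    by simp
  show "\<forall>j\<in>{1..<s}. c j = a j"
  proof
    fix j assume j: "j \<in> {1..<s}"
    then have jk: "j \<in> {1..k}" and bj: "b j = \<zero>"
      using s b0 by auto
    have "(\<Oplus>i\<in>{1..n}. \<delta> i \<otimes> b j \<otimes> \<delta>' i) = (\<Oplus>i\<in>{1..n}. \<zero>)"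
      unfolding bj using d by (intro finsum_cong') auto
    then show "c j = a j"
      using cl(1)[OF jk] by (simp add: cj[OF jk] minus_eq)
  qed
  have "a = (\<lambda>j\<in>{1..k}. c j \<oplus> (\<Oplus>i\<in>{1..n}. \<delta> i \<otimes> b j \<otimes> \<delta>' i))"
  proof
    fix j
    show "a j = (\<lambda>j\<in>{1..k}. c j \<oplus> (\<Oplus>i\<in>{1..n}. \<delta> i \<otimes> b j \<otimes> \<delta>' i)) j"
    proof (cases "j \<in> {1..k}")
      case True
      then show ?thesis
        using cl[OF True] by (simp add: cj minus_eq a_assoc l_neg)
    next
      \<comment> \<open>Outside the positions both sides are \<open>undefined\<close>.\<close>
      case False
      then show ?thesis
        using ab(1) False unfolding carrier_power_group restrict_def if_not_P[OF False]
        by (blast intro: PiE_arb)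
    qed
  qed
  with d show "\<exists>(n::nat) \<delta> \<delta>'. (\<forall>i\<in>{1..n}. \<delta> i \<in> carrier R \<and> \<delta>' i \<in> carrier R)
      \<and> a = (\<lambda>j\<in>{1..k}. c j \<oplus> (\<Oplus>i\<in>{1..n}. \<delta> i \<otimes> b j \<otimes> \<delta>' i))"
    by blast
qed

text \<open>Every reduction of the \<open>s\<close>-th entry extends to the vector:
  \<open>red_diff_in_Idl\<close> puts the difference into the ideal generated by \<open>b s\<close>,
  and any way of writing it as a finite sum gives admissible coefficients. That choice may affect
  the later entries, so only the existence of a result is claimed.\<close>

lemma vec_red_at_exists:
  assumes "a \<in> carrier (power_group R k)" "b \<in> carrier (power_group R k)" "s \<in> {1..k}"
    and "\<forall>j\<in>{1..<s}. b j = \<zero>" and r: "red (b s) (a s) \<gamma>"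
  shows "\<exists>c. vec_red_at R red k s b a c"
proof -
  obtain n :: nat and \<delta> \<delta>' where
    d: "\<forall>i\<in>{1..n}. \<delta> i \<in> carrier R \<and> \<delta>' i \<in> carrier R"
    and eq: "a s \<ominus> \<gamma> = (\<Oplus>i\<in>{1..n}. \<delta> i \<otimes> b s \<otimes> \<delta>' i)"
    using Idl_singleton_eq_sum[OF red_diff_in_Idl[OF r]] red_carrier[OF r] by blast
  have "a s = \<gamma> \<oplus> (\<Oplus>i\<in>{1..n}. \<delta> i \<otimes> b s \<otimes> \<delta>' i)"
    unfolding eq[symmetric] minus_eq
    using red_carrier[OF r] by (metis a_comm a_inv_closed a_lcomm r_neg r_zero)
  then show ?thesis
    unfolding vec_red_at_def using assms d by blast
qed

section \<open>Groebner bases of submodules from those of the leading-entry ideals\<close>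

lemma submodule_groebner_basis_of_leading_entries:
  assumes S: "two_sided_submodule R k S"
    and GB: "\<And>s. s \<in> {1..k} \<Longrightarrow>
      finite (G s) \<and> groebner_basis R red (G s) {a s | a. a \<in> S \<and> (\<forall>j\<in>{1..<s}. a j = \<zero>)}"
  shows "\<exists>B. finite B \<and> submodule_groebner_basis R red k B S"
proof -
  let ?P = "carrier (power_group R k)"
  let ?I = "\<lambda>s. {a s | a. a \<in> S \<and> (\<forall>j\<in>{1..<s}. a j = \<zero>)}"
  have SP: "S \<subseteq> ?P"
    using two_sided_submodule_subset[OF S] by (auto simp: carrier_power_group)
  have G: "finite (G s)" "G s \<subseteq> carrier R" "?I s = Idl (G s)"
    "confluentp (red_by red (G s))"
    "\<And>x y. x \<in> carrier R \<Longrightarrow> y \<in> carrier R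
      \<Longrightarrow> equivclp (red_by red (G s)) x y \<longleftrightarrow> x \<ominus> y \<in> ?I s" if "s \<in> {1..k}" for s
    using GB[OF that] unfolding groebner_basis_def complete_red_def by blast+
  have "\<exists>b. b \<in> S \<and> (\<forall>j\<in>{1..<s}. b j = \<zero>) \<and> b s = g" if "s \<in> {1..k}" "g \<in> G s" for s g
  proof -
    have "g \<in> ?I s"
      unfolding G(3)[OF that(1)] using genideal_self[OF G(2)[OF that(1)]] that(2) by blast
    then show ?thesis
      by blast
  qed
  then obtain lift where lift: "\<And>s g. s \<in> {1..k} \<Longrightarrow> g \<in> G s \<Longrightarrow>
      lift s g \<in> S \<and> (\<forall>j\<in>{1..<s}. lift s g j = \<zero>) \<and> lift s g s = g"
    by metis
  \<comment> \<open>A lift of zero could be a nonzero vector with an unwanted leading entry further right.\<close>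
  define B where "B = (\<Union>s\<in>{1..k}. lift s ` (G s - {\<zero>}))"
  let ?r = "red_by (vec_red R red k) B"
  have "finite B"
    using G(1) by (auto simp: B_def)
  have "B \<subseteq> S"
    using lift by (auto simp: B_def)
  \<comment> \<open>A reducer used at \<open>s\<close> vanishes before \<open>s\<close> and, by
    \<open>not_red_by_zero\<close>, not at \<open>s\<close>. A lift from \<open>G t\<close> has its
    first nonzero entry at \<open>t\<close>. Hence both positions agree, and the reducing entry
    comes from \<open>G s\<close>.\<close>
  have stepE: "\<exists>s\<in>{1..k}. \<exists>b\<in>B. b s \<in> G s \<and> vec_red_at R red k s b a c" if ac: "?r a c" for a c
  proof -
    obtain b s where b: "b \<in> B" and r: "vec_red_at R red k s b a c"
      using ac by (auto simp: red_by_def vec_red_def)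
    from b obtain t g where t: "t \<in> {1..k}" "g \<in> G t" "g \<noteq> \<zero>" "b = lift t g"
      unfolding B_def by blast
    have s: "s \<in> {1..k}" "\<forall>j\<in>{1..<s}. b j = \<zero>"
      using r by (auto simp: vec_red_at_def)
    have "b s \<noteq> \<zero>"
      using vec_red_atD(1)[OF r] not_red_by_zero by metis
    moreover have "b t = g" "\<forall>j\<in>{1..<t}. b j = \<zero>"
      using lift[OF t(1,2)] t(4) by auto
    ultimately have st: "s = t"
      using s t(1,3) by (metis atLeastAtMost_iff atLeastLessThan_iff linorder_neqE_nat)
    then show ?thesis
      using t(1,2) b r \<open>b t = g\<close> unfolding st by blast
  qed
  have r_terminating: "terminating ?r"
  proof (rule terminating_lexicographic)
    \<comment> \<open>The lexicographic order needs one relation for all positions. The union of the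
      bases is still finite, so reduction by it terminates.\<close>
    show "terminating (red_by red (\<Union>s\<in>{1..k}. G s))"
      using G(1,2) by (intro red_terminating UN_least) auto
    show "\<exists>s\<in>{1..k}. red_by red (\<Union>s\<in>{1..k}. G s) (a s) (c s) \<and> (\<forall>j\<in>{1..<s}. c j = a j)"
      if ac: "?r a c" for a c
    proof -
      obtain s b where "s \<in> {1..k}" "b s \<in> G s" and r: "vec_red_at R red k s b a c"
        using stepE[OF ac] by blast
      then show ?thesis
        using vec_red_atD(1,2)[OF r] unfolding red_by_def by blast
    qed
  qed
  have step_sum: "\<exists>(n::nat) \<delta> \<delta>' b. b \<in> B \<and>
      (\<forall>i\<in>{1..n}. \<delta> i \<in> carrier R \<and> \<delta>' i \<in> carrier R)
      \<and> a = (\<lambda>j\<in>{1..k}. c j \<oplus> (\<Oplus>i\<in>{1..n}. \<delta> i \<otimes> b j \<otimes> \<delta>' i))" if ac: "?r a c" for a c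
  proof -
    obtain s b where "b \<in> B" and r: "vec_red_at R red k s b a c"
      using stepE[OF ac] by blast
    then show ?thesis
      using vec_red_atD(5)[OF r] by blast
  qed
  have step_P: "a \<in> ?P \<and> c \<in> ?P" if "?r a c" for a c
    using stepE[OF that] vec_red_atD(3,4) by blast
  have step_S: "vec_minus R k a c \<in> S" if ac: "?r a c" for a c
  proof -
    obtain n :: nat and \<delta> \<delta>' b where b: "b \<in> B"
      and d: "\<forall>i\<in>{1..n}. \<delta> i \<in> carrier R \<and> \<delta>' i \<in> carrier R"
      and a: "a = (\<lambda>j\<in>{1..k}. c j \<oplus> (\<Oplus>i\<in>{1..n}. \<delta> i \<otimes> b j \<otimes> \<delta>' i))"
      using step_sum[OF ac] by blast
    have "vec_minus R k a c = (\<lambda>j\<in>{1..k}. \<Oplus>i\<in>{1..n}. \<delta> i \<otimes> b j \<otimes> \<delta>' i)"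
      unfolding vec_minus_def
    proof (rule restrict_ext)
      fix j assume j: "j \<in> {1..k}"
      have "b j \<in> carrier R" "c j \<in> carrier R"
        using j b \<open>B \<subseteq> S\<close> SP step_P[OF ac] by (auto simp: carrier_power_group PiE_iff)
      then show "a j \<ominus> c j = (\<Oplus>i\<in>{1..n}. \<delta> i \<otimes> b j \<otimes> \<delta>' i)"
        unfolding a using j sandwich_sum_closed[OF d]
        by (simp add: minus_eq a_ac r_neg r_neg1 r_neg2)
    qed
    then show ?thesis
      using two_sided_submodule_sandwich_sum[OF S _ d] b \<open>B \<subseteq> S\<close> by auto
  qed
  \<comment> \<open>The carrier is part of the relation because the ring laws behind its symmetry
    and transitivity hold only there.\<close>
  define cong where
    "cong a c \<longleftrightarrow> a \<in> ?P \<and> c \<in> ?P \<and> vec_minus R k a c \<in> S" for a c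
  have cong_refl: "cong a a" if "a \<in> ?P" for a
  proof -
    have "vec_minus R k a a = (\<lambda>j\<in>{1..k}. \<zero>)"
      unfolding vec_minus_def using that
      by (intro restrict_ext) (auto simp: carrier_power_group PiE_iff r_neg minus_eq)
    then show ?thesis
      using two_sided_submodule_zero[OF S] that by (simp add: cong_def)
  qed
  \<comment> \<open>The identity is (a - d) - (a - c) = c - d. Together with reflexivity, this
    property yields symmetry and transitivity.\<close>
  have cong_euclid: "cong c d" if "cong a c" "cong a d" for a c d
  proof -
    have "vec_minus R k (vec_minus R k a d) (vec_minus R k a c) = vec_minus R k c d"
      unfolding vec_minus_def
    proof (rule restrict_ext)
      fix j assume j: "j \<in> {1..k}"
      then have "a j \<in> carrier R" "c j \<in> carrier R" "d j \<in> carrier R"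
        using that by (auto simp: cong_def carrier_power_group PiE_iff)
      then show "(\<lambda>j\<in>{1..k}. a j \<ominus> d j) j \<ominus> (\<lambda>j\<in>{1..k}. a j \<ominus> c j) j = c j \<ominus> d j"
        using j by (simp add: minus_eq minus_add a_ac r_neg1 r_neg2)
    qed
    then show ?thesis
      using that two_sided_submodule_minus[OF S] unfolding cong_def by metis
  qed
  have cong_sym: "cong c a" if "cong a c" for a c
    using that cong_euclid cong_refl cong_def by metis
  have cong_trans: "cong a d" if "cong a c" "cong c d" for a c d
    using that cong_euclid cong_sym by metis
  have cong_step: "cong a c" if "?r a c" for a c
    using that step_P step_S by (simp add: cong_def)
  have cong_rtrancl: "cong a c" if "?r\<^sup>*\<^sup>* a c" "a \<in> ?P" for a c
    using that by induction (auto intro: cong_refl cong_trans cong_step)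
  \<comment> \<open>\<open>equivclp\<close> also relates each function outside the carrier to
    itself, hence the premise on \<open>a\<close>.\<close>
  have cong_equivclp: "cong a c" if "equivclp ?r a c" "a \<in> ?P" for a c
    using that
  proof (induction rule: equivclp_induct)
    case (step y z)
    then show ?case
      using cong_step cong_sym cong_trans by blast
  qed (rule cong_refl)
  \<comment> \<open>The reducing element is nonzero, so its lift survived the removal of zero and
    lies in \<open>B\<close>.\<close>
  have reducible: "\<exists>z. ?r a z" if "a \<in> ?P" "s \<in> {1..k}" and red: "red_by red (G s) (a s) \<gamma>" for a s \<gamma>
  proof -
    obtain g where g: "g \<in> G s" "red g (a s) \<gamma>"
      using red by (auto simp: red_by_def)
    then have "g \<noteq> \<zero>"
      using not_red_by_zero by metis
    then have b: "lift s g \<in> B"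
      using g(1) that(2) by (auto simp: B_def)
    have "\<exists>z. vec_red_at R red k s (lift s g) a z"
      using lift[OF that(2) g(1)] g(2) b that \<open>B \<subseteq> S\<close> SP
      by (intro vec_red_at_exists) auto
    then show ?thesis
      using b by (auto simp: red_by_def vec_red_def)
  qed
  have normal_eq: "a = c" if ac: "cong a c" and na: "\<And>z. \<not> ?r a z" and nc: "\<And>z. \<not> ?r c z" for a c
  proof (rule ccontr)
    assume "a \<noteq> c"
    have P: "a \<in> ?P" "c \<in> ?P"
      using ac by (auto simp: cong_def)
    then have "\<exists>s. s \<in> {1..k} \<and> a s \<noteq> c s"
      using \<open>a \<noteq> c\<close> unfolding carrier_power_group by (metis PiE_ext)
    then obtain s where s: "s \<in> {1..k}" "a s \<noteq> c s"
      and least: "\<And>j. j < s \<Longrightarrow> \<not> (j \<in> {1..k} \<and> a j \<noteq> c j)"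
      using exists_least_iff[of "\<lambda>s. s \<in> {1..k} \<and> a s \<noteq> c s"] by blast
    have cl: "a j \<in> carrier R" "c j \<in> carrier R" if "j \<in> {1..k}" for j
      using P that by (auto simp: carrier_power_group PiE_iff)
    \<comment> \<open>By minimality of \<open>s\<close> the difference vanishes before
      \<open>s\<close>. As an element of \<open>S\<close> it witnesses that its \<open>s\<close>-th
      entry belongs to the leading-entry ideal.\<close>
    have "vec_minus R k a c j = \<zero>" if "j \<in> {1..<s}" for j
    proof -
      have "j \<in> {1..k}" "a j = c j"
        using that s(1) least[of j] by auto
      then show ?thesis
        using cl by (simp add: vec_minus_def minus_eq r_neg)
    qed
    moreover have "vec_minus R k a c s = a s \<ominus> c s"
      using s(1) by (simp add: vec_minus_def)
    ultimately have "a s \<ominus> c s \<in> ?I s"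
      using ac unfolding cong_def mem_Collect_eq by (intro exI[of _ "vec_minus R k a c"]) simp
    then have "equivclp (red_by red (G s)) (a s) (c s)"
      using G(5)[OF s(1)] cl[OF s(1)] by blast
    then obtain z where "(red_by red (G s))\<^sup>*\<^sup>* (a s) z" "(red_by red (G s))\<^sup>*\<^sup>* (c s) z"
      using G(4)[OF s(1)] by (auto simp: semiconfluentp_equivclp confluentp_eq_semiconfluentp rtranclp_conversep)
    moreover have "\<not> red_by red (G s) (a s) \<gamma>" "\<not> red_by red (G s) (c s) \<gamma>" for \<gamma>
      using reducible[OF P(1) s(1)] reducible[OF P(2) s(1)] na nc by blast+
    \<comment> \<open>Both entries are irreducible, so each coincides with the common
      reduct.\<close>
    ultimately have "a s = z" "c s = z"
      by (auto elim: converse_rtranclpE)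
    with s(2) show False
      by simp
  qed
  have join: "\<exists>z. ?r\<^sup>*\<^sup>* a z \<and> ?r\<^sup>*\<^sup>* c z" if "cong a c" for a c
  proof -
    obtain a' where a': "?r\<^sup>*\<^sup>* a a'" "\<And>z. \<not> ?r a' z"
      using terminating_normal_form[OF r_terminating] by blast
    obtain c' where c': "?r\<^sup>*\<^sup>* c c'" "\<And>z. \<not> ?r c' z"
      using terminating_normal_form[OF r_terminating] by blast
    have "cong a a'" "cong c c'"
      using that cong_rtrancl[OF a'(1)] cong_rtrancl[OF c'(1)] by (auto simp: cong_def)
    then have "cong a' c'"
      using that cong_euclid cong_trans by blast
    then have "a' = c'"
      using normal_eq a'(2) c'(2) by blast
    then show ?thesis
      using a'(1) c'(1) by blast
  qed
  have confl: "confluentp ?r"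
  proof (rule confluentpI)
    fix x y y' assume xy: "?r\<^sup>*\<^sup>* x y" "?r\<^sup>*\<^sup>* x y'"
    show "\<exists>z. ?r\<^sup>*\<^sup>* y z \<and> ?r\<^sup>*\<^sup>* y' z"
    proof (cases "x \<in> ?P")
      case True
      then show ?thesis
        using xy cong_rtrancl cong_euclid join by blast
    next
      \<comment> \<open>No step starts outside the carrier, so both reducts are \<open>x\<close>
        itself.\<close>
      case False
      then have "y = x" "y' = x"
        using xy step_P by (auto elim: converse_rtranclpE)
      then show ?thesis
        by blast
    qed
  qed
  let ?z = "\<lambda>j\<in>{1..k}. \<zero>"
  have z_normal: "\<not> ?r ?z c" for c
  proof
    assume "?r ?z c"
    then obtain s b where "s \<in> {1..k}" and r: "vec_red_at R red k s b ?z c"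
      using stepE by blast
    with vec_red_atD(1)[OF r] show False
      using zero_irreducible by simp
  qed
  have gen: "S = generated_submodule R k B"
  proof
    show "generated_submodule R k B \<subseteq> S"
      using S \<open>B \<subseteq> S\<close> by (rule generated_submodule_subset)
    show "S \<subseteq> generated_submodule R k B"
    proof
      fix a assume a: "a \<in> S"
      have zP: "?z \<in> ?P"
        using two_sided_submodule_zero[OF S] SP by blast
      have "cong a ?z"
        using a SP zP two_sided_submodule_minus[OF S a two_sided_submodule_zero[OF S]]
        by (auto simp: cong_def)
      then obtain w where "?r\<^sup>*\<^sup>* a w" "?r\<^sup>*\<^sup>* ?z w"
        using join by blast
      then have "?r\<^sup>*\<^sup>* a ?z"
        using z_normal by (auto elim: converse_rtranclpE)
      then show "a \<in> generated_submodule R k B"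
      \<comment> \<open>Going backwards from zero, each step adds a sum of two-sided multiples of
        one element of \<open>B\<close>.\<close>
      proof (induction rule: converse_rtranclp_induct)
        case base
        show ?case
          by (rule zero_in_generated_submodule)
      next
        case (step x y)
        then show ?case
          using step_sum[OF step.hyps(1)] \<open>B \<subseteq> S\<close> SP
            generated_submodule_add_sandwich_sum[OF step.IH]
          by blast
      qed
    qed
  qed
  have "equivclp ?r a c \<longleftrightarrow> vec_minus R k a c \<in> S" if "a \<in> ?P" "c \<in> ?P" for a c
  proof
    show "vec_minus R k a c \<in> S" if "equivclp ?r a c"
      using cong_equivclp[OF that \<open>a \<in> ?P\<close>] by (simp add: cong_def)
    assume "vec_minus R k a c \<in> S"
    then have "cong a c"
      using that by (simp add: cong_def)
    then obtain z where "?r\<^sup>*\<^sup>* a z" "?r\<^sup>*\<^sup>* c z"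
      using join by blast
    then show "equivclp ?r a c"
      by (rule equivclp_trans[OF rtranclp_into_equivclp converse_rtranclp_into_equivclp])
  qed
  then have "submodule_groebner_basis R red k B S"
    using \<open>B \<subseteq> S\<close> SP gen r_terminating confl
    unfolding submodule_groebner_basis_def complete_red_def by blast
  with \<open>finite B\<close> show ?thesis
    by blast
qed

end

theorem theorem3p4p7:
  fixes R :: "('a, 'm) ring_scheme"
    and red :: "'a \<Rightarrow> 'a \<Rightarrow> 'a \<Rightarrow> bool"
    and k :: nat
  assumes "noetherian_ring R"
    and "reduction_relation R red"
    and "k \<ge> 1"
    and "\<forall>I. ideal I R \<longrightarrow> (\<exists>B. finite B \<and> groebner_basis R red B I)"
  shows "\<forall>S. two_sided_submodule R k S \<longrightarrow>
           (\<exists>B. finite B \<and> submodule_groebner_basis R red k B S)"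
proof (intro allI impI)
  interpret reduction_relation R red
    by fact
  fix S assume S: "two_sided_submodule R k S"
  \<comment> \<open>One basis is obtained for each position; a choice function then collects them
    into the family \<open>G\<close>.\<close>
  have "\<forall>s\<in>{1..k}. \<exists>G. finite G \<and>
      groebner_basis R red G {a s | a. a \<in> S \<and> (\<forall>j\<in>{1..<s}. a j = \<zero>\<^bsub>R\<^esub>)}"
    using assms(4)[rule_format, OF ideal_leading_entries[OF S]] by (rule ballI)
  from bchoice[OF this] obtain G where "\<And>s. s \<in> {1..k} \<Longrightarrow> finite (G s) \<and>
      groebner_basis R red (G s) {a s | a. a \<in> S \<and> (\<forall>j\<in>{1..<s}. a j = \<zero>\<^bsub>R\<^esub>)}"
    by blast
  with S show "\<exists>B. finite B \<and> submodule_groebner_basis R red k B S"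
    by (rule submodule_groebner_basis_of_leading_entries)
qed

end
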